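(* Let $p>0$ be a real number. (1) If $p\ge\frac{2}{\pi}$, then $$\frac{(\pi/2)\sin x}{1+p\cos x}\le x\le\frac{(1+p)\sin x}{1+p\cos x}\quad\text{for all } 0\le x\le\frac{\pi}{2}.$$ (2) If $p\le\frac12$, then the double inequality in (1) reverses, that is, $$\frac{(1+p)\sin x}{1+p\cos x}\le x\le\frac{(\pi/2)\sin x}{1+p\cos x}\quad\text{for all } 0\le x\le\frac{\pi}{2}.$$ (3) If $\frac12<p<\frac{2}{\pi}$, then $$\frac{4p(1-p^2)\sin x}{1+p\cos x}\le x\le\frac{\max\{\pi/2,\,1+p\}\sin x}{1+p\cos x}\quad\text{for all } 0\le x\le\frac{\pi}{2}.$$ Moreover, the constants $\frac{\pi}{2}$ and $1+p$ appearing in these inequalities are the best possible.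
   Context: "Best possible" is understood as follows, for each fixed $p$ in the relevant range. Consider the inequalities $\frac{q\sin x}{1+p\cos x}\le x$ and $x\le\frac{r\sin x}{1+p\cos x}$, each required to hold for all $0\le x\le\frac{\pi}{2}$, with $q,r$ real constants (independent of $x$). In case (1), $q=\frac{\pi}{2}$ is the greatest admissible $q$ and $r=1+p$ is the least admissible $r$. In case (2), $q=1+p$ is the greatest admissible $q$ and $r=\frac{\pi}{2}$ is the least admissible $r$. In case (3), $r=\max\{\frac{\pi}{2},1+p\}$ is the least admissible $r$; no optimality is claimed for the constant $4p(1-p^2)$. *)

theory Defs
  imports Complex_Main
begin

definition lower_consts :: "real \<Rightarrow> real set" where
  "lower_consts p = {q. \<forall>x\<in>{0..pi/2}. (q * sin x) / (1 + p * cos x) \<le> x}"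

definition upper_consts :: "real \<Rightarrow> real set" where
  "upper_consts p = {r. \<forall>x\<in>{0..pi/2}. x \<le> (r * sin x) / (1 + p * cos x)}"

end

theory Submission
  imports Defs "HOL-Analysis.Complex_Transcendental"
begin

text \<open>
  Write \<open>G x = x - k sin x / (1 + p cos x)\<close>. Both halves of every double inequality say that \<open>G\<close> has a
  constant sign on \<open>[0, pi/2]\<close>, and one computation controls all of them:
  \<open>G' x = Q (cos x) / (1 + p cos x)\<^sup>2\<close> with the quadratic \<open>Q t = (1 + p t)\<^sup>2 - k (t + p)\<close>
  (\<open>G\<close> is \<open>gap p k\<close> and \<open>Q\<close> is \<open>slope_poly p k\<close> below), which is convex in \<open>t\<close>.

  In the two lower estimates of parts (2) and (3), \<open>Q\<close> is nonnegative on the whole of \<open>[0, 1]\<close>, so \<open>G\<close>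
  increases from \<open>G 0 = 0\<close>. For \<open>k = 1 + p\<close> the quadratic factors as
  \<open>(1 - t) (1 - p - p\<^sup>2 - p\<^sup>2 t)\<close>, and the second factor is smallest at \<open>t = 1\<close>, where it equals
  \<open>(1 + p) (1 - 2 p)\<close>. For \<open>k = 4 p (1 - p\<^sup>2)\<close> it is the square of \<open>p t - (1 - 2 p\<^sup>2)\<close>.

  In all remaining estimates \<open>Q\<close> may change sign, but convexity allows only one change, in a known
  direction. The upper estimate holds for every \<open>p > 0\<close> with \<open>k = max (pi/2) (1 + p)\<close>: here
  \<open>Q 1 \<le> 0\<close>, so \<open>G\<close> first decreases and then increases, and it is \<open>\<le> 0\<close> at both ends. In the lower
  estimate of part (1), \<open>Q 0 \<le> 0\<close>, so \<open>G\<close> first increases and then decreases, and it vanishes at both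
  ends. Rough bounds for \<open>pi\<close> decide which of \<open>pi/2\<close> and \<open>1 + p\<close> is the maximum in parts (1) and (2).

  The constants are best possible because \<open>x (1 + p cos x) / sin x\<close> tends to \<open>1 + p\<close> at \<open>0\<close> and equals
  \<open>pi/2\<close> at \<open>pi/2\<close>: an admissible lower constant is at most, and an admissible upper constant at least,
  both of these numbers.
\<close>

definition gap :: "real \<Rightarrow> real \<Rightarrow> real \<Rightarrow> real" where
  "gap p k x = x - k * sin x / (1 + p * cos x)"

definition slope_poly :: "real \<Rightarrow> real \<Rightarrow> real \<Rightarrow> real" where
  "slope_poly p k t = (1 + p * t)\<^sup>2 - k * (t + p)"

lemma gap_0 [simp]: "gap p k 0 = 0"
  and gap_pi_half [simp]: "gap p k (pi/2) = pi/2 - k"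
  by (simp_all add: gap_def)

lemma denominator_pos:
  assumes "p > 0" "x \<in> {0..pi/2}"
  shows "1 + p * cos x > 0"
proof -
  have "cos x \<ge> 0" using assms by (intro cos_ge_zero) auto
  then have "p * cos x \<ge> 0" using assms(1) by simp
  then show ?thesis by simp
qed

lemma gap_has_derivative:
  assumes "p > 0" "x \<in> {0..pi/2}"
  shows "(gap p k has_real_derivative slope_poly p k (cos x) / (1 + p * cos x)\<^sup>2) (at x)"
proof -
  have nz: "1 + p * cos x \<noteq> 0" using denominator_pos[OF assms] by simp
  have s: "sin x * sin x = 1 - cos x * cos x"
    using sin_squared_eq[of x] by (simp add: power2_eq_square)
  have "(gap p k has_real_derivative
      1 - (k * cos x * (1 + p * cos x) - k * sin x * (- (p * sin x))) / (1 + p * cos x)\<^sup>2) (at x)"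
    unfolding gap_def[abs_def] using nz
    by (auto intro!: derivative_eq_intros simp: power2_eq_square)
  also have "k * cos x * (1 + p * cos x) - k * sin x * (- (p * sin x))
      = k * cos x * (1 + p * cos x) + k * p * (sin x * sin x)"
    by (simp add: algebra_simps)
  also have "\<dots> = k * (cos x + p)"
    unfolding s by (simp add: algebra_simps)
  also have "1 - k * (cos x + p) / (1 + p * cos x)\<^sup>2 = slope_poly p k (cos x) / (1 + p * cos x)\<^sup>2"
    using nz by (simp add: slope_poly_def diff_divide_distrib)
  finally show ?thesis .
qed

lemma slope_poly_between:
  assumes "a \<le> b" "b \<le> c" "slope_poly p k a \<le> 0" "slope_poly p k c \<le> 0"
  shows "slope_poly p k b \<le> 0"
proof (cases "a = c")
  case True
  with assms show ?thesis by simp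
next
  case False
  with assms have ac: "c - a > 0" by simp
  \<comment> \<open>The convexity inequality between \<open>a\<close> and \<open>c\<close>, with its exact defect.\<close>
  have "(c - a) * slope_poly p k b
      = (c - b) * slope_poly p k a + (b - a) * slope_poly p k c - p\<^sup>2 * ((c - a) * (b - a) * (c - b))"
    unfolding slope_poly_def by algebra
  also have "\<dots> \<le> 0"
  proof -
    have "(c - b) * slope_poly p k a \<le> 0" "(b - a) * slope_poly p k c \<le> 0"
      using assms by (simp_all add: mult_nonneg_nonpos)
    moreover have "p\<^sup>2 * ((c - a) * (b - a) * (c - b)) \<ge> 0"
      using assms ac by simp
    ultimately show ?thesis by linarith
  qed
  finally show ?thesis using ac by (simp add: mult_le_0_iff)
qed

text \<open>A chord of \<open>gap\<close> has the sign of \<open>slope_poly\<close> at the cosine of an intermediate point; in this form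
  the sign of \<open>gap\<close> can be read off from the quadratic without locating its roots.\<close>

lemma gap_mvt:
  assumes "p > 0" "0 \<le> a" "a < b" "b \<le> pi/2"
  obtains z d where "a < z" "z < b" "d > 0" "gap p k b - gap p k a = d * slope_poly p k (cos z)"
proof -
  have "(gap p k has_real_derivative slope_poly p k (cos x) / (1 + p * cos x)\<^sup>2) (at x)"
    if "a \<le> x" "x \<le> b" for x
    using that assms by (intro gap_has_derivative) auto
  from MVT2[OF assms(3) this] obtain z where z: "a < z" "z < b"
    "gap p k b - gap p k a = (b - a) * (slope_poly p k (cos z) / (1 + p * cos z)\<^sup>2)"
    by blast
  have "1 + p * cos z > 0" using denominator_pos[OF assms(1), of z] z assms by auto
  then have "(b - a) / (1 + p * cos z)\<^sup>2 > 0" using assms by simp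
  with that[of z "(b - a) / (1 + p * cos z)\<^sup>2"] z show ?thesis by simp
qed

lemma gap_nonneg_if_slope_nonneg:
  assumes "p > 0" and slope: "\<And>t. 0 \<le> t \<Longrightarrow> t \<le> 1 \<Longrightarrow> slope_poly p k t \<ge> 0"
    and x: "x \<in> {0..pi/2}"
  shows "gap p k x \<ge> 0"
proof (cases "x = 0")
  case False
  then obtain z d where z: "0 < z" "z < x" "d > 0" "gap p k x - gap p k 0 = d * slope_poly p k (cos z)"
    using gap_mvt[OF assms(1), of 0 x] x by auto
  have "cos z \<ge> 0" using z x by (intro cos_ge_zero) auto
  then have "slope_poly p k (cos z) \<ge> 0" by (intro slope) auto
  with z show ?thesis by simp
qed simp

text \<open>If \<open>gap\<close> were positive at \<open>x\<close>, the quadratic would be positive at some \<open>cos y\<close> with \<open>y < x\<close> and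
  negative at some \<open>cos z\<close> with \<open>z > x\<close>; as it is \<open>\<le> 0\<close> at \<open>1\<close>, this contradicts convexity at the
  intermediate point \<open>cos y\<close>.\<close>

lemma gap_nonpos:
  assumes "p > 0" "k \<ge> pi/2" "k \<ge> 1 + p" and x: "x \<in> {0..pi/2}"
  shows "gap p k x \<le> 0"
proof (rule ccontr)
  assume "\<not> ?thesis"
  then have pos: "gap p k x > 0" by simp
  have "gap p k 0 \<le> 0" "gap p k (pi/2) \<le> 0" using assms(2) by simp_all
  with pos have "x \<noteq> 0" "x \<noteq> pi/2" by (metis not_le)+
  with x have "0 < x" "x < pi/2" by auto
  obtain y d where y: "0 < y" "y < x" "d > 0" "gap p k x - gap p k 0 = d * slope_poly p k (cos y)"
    using gap_mvt[OF assms(1), of 0 x] \<open>0 < x\<close> \<open>x < pi/2\<close> by auto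
  obtain z e where z: "x < z" "z < pi/2" "e > 0"
    "gap p k (pi/2) - gap p k x = e * slope_poly p k (cos z)"
    using gap_mvt[OF assms(1), of x "pi/2"] \<open>0 < x\<close> \<open>x < pi/2\<close> by auto
  have Qy: "slope_poly p k (cos y) > 0"
    using y pos by (simp add: zero_less_mult_iff)
  have "e * slope_poly p k (cos z) < 0"
    using z(4) pos assms(2) by simp
  then have Qz: "slope_poly p k (cos z) \<le> 0"
    using z(3) by (simp add: mult_less_0_iff)
  have "slope_poly p k 1 = (1 + p) * (1 + p - k)"
    unfolding slope_poly_def by algebra
  also have "\<dots> \<le> 0" using assms by (intro mult_nonneg_nonpos) auto
  finally have Q1: "slope_poly p k 1 \<le> 0" .
  have "cos z \<le> cos y" using y z by (intro cos_monotone_0_pi_le) auto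
  then have "slope_poly p k (cos y) \<le> 0"
    using Qz Q1 by (intro slope_poly_between[of "cos z" "cos y" 1]) auto
  with Qy show False by simp
qed

text \<open>The mirror image of the previous argument, with the roles of the two end points exchanged: here the
  quadratic is \<open>\<le> 0\<close> at \<open>0 = cos (pi/2)\<close>.\<close>

lemma gap_nonneg:
  assumes "p \<ge> 2/pi" and x: "x \<in> {0..pi/2}"
  shows "gap p (pi/2) x \<ge> 0"
proof (rule ccontr)
  define k where "k = pi/2"
  have "2/pi > 0" by simp
  with assms(1) have p: "p > 0" by linarith
  assume "\<not> ?thesis"
  then have neg: "gap p k x < 0" by (simp add: k_def)
  have "gap p k 0 \<ge> 0" "gap p k (pi/2) \<ge> 0" by (simp_all add: k_def)
  with neg have "x \<noteq> 0" "x \<noteq> pi/2" by (metis not_le)+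
  with x have "0 < x" "x < pi/2" by auto
  obtain y d where y: "0 < y" "y < x" "d > 0" "gap p k x - gap p k 0 = d * slope_poly p k (cos y)"
    using gap_mvt[OF p, of 0 x] \<open>0 < x\<close> \<open>x < pi/2\<close> by auto
  obtain z e where z: "x < z" "z < pi/2" "e > 0"
    "gap p k (pi/2) - gap p k x = e * slope_poly p k (cos z)"
    using gap_mvt[OF p, of x "pi/2"] \<open>0 < x\<close> \<open>x < pi/2\<close> by auto
  have "d * slope_poly p k (cos y) < 0" using y neg by simp
  then have Qy: "slope_poly p k (cos y) \<le> 0"
    using y(3) by (simp add: mult_less_0_iff)
  have "e * slope_poly p k (cos z) > 0"
    using z(4) neg by (simp add: k_def)
  then have Qz: "slope_poly p k (cos z) > 0"
    using z(3) by (simp add: zero_less_mult_iff)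
  have Q0: "slope_poly p k 0 \<le> 0"
    using assms(1) by (simp add: slope_poly_def k_def field_simps)
  have "0 \<le> cos z" "cos z \<le> cos y"
    using y z by (auto intro!: cos_ge_zero cos_monotone_0_pi_le)
  then have "slope_poly p k (cos z) \<le> 0"
    using Qy Q0 by (intro slope_poly_between[of 0 "cos z" "cos y"]) auto
  with Qz show False by simp
qed

lemma slope_poly_nonneg_small:
  assumes "p > 0" "p \<le> 1/2" "0 \<le> t" "t \<le> 1"
  shows "slope_poly p (1 + p) t \<ge> 0"
proof -
  have "p\<^sup>2 * t \<le> p\<^sup>2" using assms by (simp add: mult_left_le)
  then have "1 - p - p\<^sup>2 - p\<^sup>2 * t \<ge> 1 - p - p\<^sup>2 - p\<^sup>2" by simp
  moreover have "1 - p - p\<^sup>2 - p\<^sup>2 = (1 + p) * (1 - 2 * p)" by algebra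
  moreover have "(1 + p) * (1 - 2 * p) \<ge> 0" using assms by simp
  ultimately have "1 - p - p\<^sup>2 - p\<^sup>2 * t \<ge> 0" by linarith
  with assms have "(1 - t) * (1 - p - p\<^sup>2 - p\<^sup>2 * t) \<ge> 0" by simp
  moreover have "slope_poly p (1 + p) t = (1 - t) * (1 - p - p\<^sup>2 - p\<^sup>2 * t)"
    unfolding slope_poly_def by algebra
  ultimately show ?thesis by simp
qed

text \<open>For \<open>0 < p < 1\<close> the constant \<open>4 p (1 - p\<^sup>2)\<close> is the minimum of \<open>(1 + p t)\<^sup>2 / (t + p)\<close> over \<open>t > - p\<close>,
  that is, the largest \<open>k\<close> for which the quadratic is nonnegative there; hence the perfect square.\<close>

lemma slope_poly_nonneg_square: "slope_poly p (4 * p * (1 - p\<^sup>2)) t \<ge> 0"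
proof -
  have "slope_poly p (4 * p * (1 - p\<^sup>2)) t = (p * t - (1 - 2 * p\<^sup>2))\<^sup>2"
    unfolding slope_poly_def by algebra
  then show ?thesis by simp
qed

lemma tendsto_at_right_0:
  fixes p q :: real
  shows
  "((\<lambda>x. q * (sin x / x)) \<longlongrightarrow> q) (at_right 0)"
  "((\<lambda>x. 1 + p * cos x) \<longlongrightarrow> 1 + p) (at_right (0::real))"
proof -
  have "((\<lambda>x. sin x / x) \<longlongrightarrow> 1) (at (0::real))"
    using DERIV_D[OF DERIV_sin[of "0::real"]] by simp
  then have "((\<lambda>x. sin x / x) \<longlongrightarrow> 1) (at_right (0::real))"
    by (rule tendsto_within_subset) simp
  from tendsto_mult_left[OF this, of q]
  show "((\<lambda>x. q * (sin x / x)) \<longlongrightarrow> q) (at_right 0)" by simp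
  have "((\<lambda>x. 1 + p * cos x) \<longlongrightarrow> 1 + p * cos 0) (at_right (0::real))"
    by (intro tendsto_intros)
  then show "((\<lambda>x. 1 + p * cos x) \<longlongrightarrow> 1 + p) (at_right (0::real))" by simp
qed

lemma eventually_first_quadrant: "eventually (\<lambda>x::real. 0 < x \<and> x < pi/2) (at_right 0)"
  by (auto intro: exI[of _ "pi/2"] simp: eventually_at_right_field)

lemma lower_consts_bounds:
  assumes "p > 0" "q \<in> lower_consts p"
  shows "q \<le> pi/2" "q \<le> 1 + p"
proof -
  have *: "q * sin x / (1 + p * cos x) \<le> x" if "x \<in> {0..pi/2}" for x
    using assms(2) that by (auto simp: lower_consts_def)
  from *[of "pi/2"] show "q \<le> pi/2" by simp
  have "eventually (\<lambda>x. q * (sin x / x) \<le> 1 + p * cos x) (at_right 0)"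
    using eventually_first_quadrant
  proof eventually_elim
    case (elim x)
    then have "1 + p * cos x > 0" using denominator_pos[OF assms(1), of x] by simp
    with elim *[of x] show ?case by (simp add: field_simps)
  qed
  then show "q \<le> 1 + p"
    by (rule tendsto_le[OF trivial_limit_at_right_real tendsto_at_right_0(2,1)])
qed

lemma upper_consts_bounds:
  assumes "p > 0" "r \<in> upper_consts p"
  shows "pi/2 \<le> r" "1 + p \<le> r"
proof -
  have *: "x \<le> r * sin x / (1 + p * cos x)" if "x \<in> {0..pi/2}" for x
    using assms(2) that by (auto simp: upper_consts_def)
  from *[of "pi/2"] show "pi/2 \<le> r" by simp
  have "eventually (\<lambda>x. 1 + p * cos x \<le> r * (sin x / x)) (at_right 0)"
    using eventually_first_quadrant
  proof eventually_elim
    case (elim x)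
    then have "1 + p * cos x > 0" using denominator_pos[OF assms(1), of x] by simp
    with elim *[of x] show ?case by (simp add: field_simps)
  qed
  then show "1 + p \<le> r"
    by (rule tendsto_le[OF trivial_limit_at_right_real tendsto_at_right_0(1,2)])
qed

theorem theorem2:
  fixes p :: real
  assumes "p > 0"
  shows
    "(p \<ge> 2 / pi \<longrightarrow>
        (\<forall>x\<in>{0..pi/2}. ((pi/2) * sin x) / (1 + p * cos x) \<le> x \<and>
                       x \<le> ((1 + p) * sin x) / (1 + p * cos x)) \<and>
        (\<forall>q\<in>lower_consts p. q \<le> pi/2) \<and>
        (\<forall>r\<in>upper_consts p. 1 + p \<le> r)) \<and>
     (p \<le> 1/2 \<longrightarrow>
        (\<forall>x\<in>{0..pi/2}. ((1 + p) * sin x) / (1 + p * cos x) \<le> x \<and>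
                       x \<le> ((pi/2) * sin x) / (1 + p * cos x)) \<and>
        (\<forall>q\<in>lower_consts p. q \<le> 1 + p) \<and>
        (\<forall>r\<in>upper_consts p. pi/2 \<le> r)) \<and>
     (1/2 < p \<and> p < 2 / pi \<longrightarrow>
        (\<forall>x\<in>{0..pi/2}. (4 * p * (1 - p^2) * sin x) / (1 + p * cos x) \<le> x \<and>
                       x \<le> (max (pi/2) (1 + p) * sin x) / (1 + p * cos x)) \<and>
        (\<forall>r\<in>upper_consts p. max (pi/2) (1 + p) \<le> r))"
proof -
  have lower: "k * sin x / (1 + p * cos x) \<le> x" if "gap p k x \<ge> 0" for k x
    using that by (simp add: gap_def)
  have upper: "x \<le> k * sin x / (1 + p * cos x)"
    if "k \<ge> pi/2" "k \<ge> 1 + p" "x \<in> {0..pi/2}" for k x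
    using gap_nonpos[OF assms that] by (simp add: gap_def)
  have large: "pi/2 \<le> 1 + p" if "p \<ge> 2/pi"
  proof -
    have pi: "pi \<le> 16/5" using pi_approx(2) by simp
    then have "2/pi \<ge> 2/(16/5)" by (intro divide_left_mono) auto
    with that pi show ?thesis by simp
  qed
  have small: "1 + p \<le> pi/2" if "p \<le> 1/2"
    using that pi_gt3 by simp
  show ?thesis
  proof (intro conjI impI ballI)
    fix x :: real
    assume x: "x \<in> {0..pi/2}"
    show "(pi/2) * sin x / (1 + p * cos x) \<le> x" if "p \<ge> 2/pi"
      by (rule lower[OF gap_nonneg[OF that x]])
    show "x \<le> (1 + p) * sin x / (1 + p * cos x)" if "p \<ge> 2/pi"
      by (rule upper[OF large[OF that] order_refl x])
    show "(1 + p) * sin x / (1 + p * cos x) \<le> x" if "p \<le> 1/2"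
      by (rule lower[OF gap_nonneg_if_slope_nonneg[OF assms _ x]])
        (rule slope_poly_nonneg_small[OF assms that])
    show "x \<le> (pi/2) * sin x / (1 + p * cos x)" if "p \<le> 1/2"
      by (rule upper[OF order_refl small[OF that] x])
    show "4 * p * (1 - p^2) * sin x / (1 + p * cos x) \<le> x"
      by (rule lower[OF gap_nonneg_if_slope_nonneg[OF assms slope_poly_nonneg_square x]])
    show "x \<le> max (pi/2) (1 + p) * sin x / (1 + p * cos x)"
      by (rule upper[OF max.cobounded1 max.cobounded2 x])
  qed (use lower_consts_bounds[OF assms] upper_consts_bounds[OF assms] in auto)
qed

end
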